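(* Let $L$ be a primitive Gaussian line, with associated Gaussian integers $\alpha_0$ and $\delta$. Let $\pi$ be a Gaussian prime that is not an associate of a rational integer. Then $\pi$ is in the Gaussian-prime set $\mathcal{GP}(L)$ of $L$ if and only if $\pi$ does not divide $\delta$.
   Context: A Gaussian line is a line in the complex plane containing at least two (hence infinitely many) elements of $\mathbb{Z}[i]$. It is primitive if the Gaussian integers on it do not all share a common non-unit divisor in $\mathbb{Z}[i]$. For a Gaussian line $L$, $\alpha_0=a+bi$ denotes the Gaussian integer on $L$ of minimum norm $N(x+iy)=x^2+y^2$ (if there are two, the one with larger real part). If $L$ is vertical, $\delta=i$; otherwise $\delta=c+di=\alpha_1-\alpha_0$, where $\alpha_1$ is the Gaussian integer on $L$ closest to $\alpha_0$ with $\mathrm{Re}(\alpha_1)>\mathrm{Re}(\alpha_0)$. Then the Gaussian integers on $L$ are exactly $\alpha_n=\alpha_0+\delta n$, $n\in\mathbb{Z}$. A Gaussian prime is a prime element of $\mathbb{Z}[i]$; two Gaussian integers are associates if they differ by a factor in $\{\pm1,\pm i\}$. The Gaussian-prime set $\mathcal{GP}(L)$ of $L$ is the set of Gaussian primes $\pi$, not associates of rational integers, such that $\pi\mid\alpha_n$ for some $n\in\mathbb{Z}$. *)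

theory Defs
  imports "HOL-Analysis.Analysis" "HOL-Computational_Algebra.Factorial_Ring"
begin

text \<open>
  The ring of Gaussian integers is a type of its own, so that \<open>dvd\<close> and
  \<open>prime_elem\<close> refer to divisibility in that ring and not in the field of complex numbers.
\<close>

typedef gauss_int = "{z :: complex. Re z \<in> \<int> \<and> Im z \<in> \<int>}"
  morphisms complex_of_gauss Abs_gauss_int
  by (rule exI[of _ 0]) simp

setup_lifting type_definition_gauss_int

instantiation gauss_int :: idom
begin

lift_definition zero_gauss_int :: gauss_int is 0 by simp
lift_definition one_gauss_int :: gauss_int is 1 by simp
lift_definition plus_gauss_int :: "gauss_int \<Rightarrow> gauss_int \<Rightarrow> gauss_int" is "(+)" by simp
lift_definition minus_gauss_int :: "gauss_int \<Rightarrow> gauss_int \<Rightarrow> gauss_int" is "(-)" by simp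
lift_definition uminus_gauss_int :: "gauss_int \<Rightarrow> gauss_int" is uminus by simp
lift_definition times_gauss_int :: "gauss_int \<Rightarrow> gauss_int \<Rightarrow> gauss_int" is "(*)" by simp

instance
  by standard (transfer; simp add: algebra_simps)+

end

lift_definition gauss_i :: gauss_int is \<i> by simp

definition gauss_norm :: "gauss_int \<Rightarrow> real" where
  "gauss_norm z = (Re (complex_of_gauss z))\<^sup>2 + (Im (complex_of_gauss z))\<^sup>2"

definition gauss_associates :: "gauss_int \<Rightarrow> gauss_int \<Rightarrow> bool" where
  "gauss_associates x y \<longleftrightarrow> (\<exists>u\<in>{1, -1, gauss_i, -gauss_i}. x = u * y)"

definition associate_of_rational_int :: "gauss_int \<Rightarrow> bool" where
  "associate_of_rational_int x \<longleftrightarrow> (\<exists>n::int. gauss_associates x (of_int n))"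

definition gauss_ints_on :: "complex set \<Rightarrow> gauss_int set" where
  "gauss_ints_on L = {z. complex_of_gauss z \<in> L}"

text \<open>The dimension in \<open>aff_dim\<close> is the real one.\<close>

definition gaussian_line :: "complex set \<Rightarrow> bool" where
  "gaussian_line L \<longleftrightarrow> affine L \<and> aff_dim L = 1 \<and>
     (\<exists>z\<in>gauss_ints_on L. \<exists>w\<in>gauss_ints_on L. z \<noteq> w)"

definition primitive_line :: "complex set \<Rightarrow> bool" where
  "primitive_line L \<longleftrightarrow> \<not> (\<exists>d. \<not> d dvd 1 \<and> (\<forall>z\<in>gauss_ints_on L. d dvd z))"

definition vertical_line :: "complex set \<Rightarrow> bool" where
  "vertical_line L \<longleftrightarrow> (\<exists>c. L = {z. Re z = c})"

text \<open>
  On a Gaussian line the descriptions below are uniquely satisfied (the second one provided the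
  line is not vertical).  At most two points of a line share the minimum norm, and if there are
  two such Gaussian integers, the line is not vertical (a vertical Gaussian line meets the real
  axis in a Gaussian integer), so their real parts differ.
\<close>

definition line_alpha0 :: "complex set \<Rightarrow> gauss_int" where
  "line_alpha0 L = (THE a. a \<in> gauss_ints_on L \<and>
     (\<forall>b\<in>gauss_ints_on L. gauss_norm a \<le> gauss_norm b) \<and>
     (\<forall>b\<in>gauss_ints_on L. gauss_norm b = gauss_norm a \<longrightarrow>
        Re (complex_of_gauss b) \<le> Re (complex_of_gauss a)))"

definition line_alpha1 :: "complex set \<Rightarrow> gauss_int" where
  "line_alpha1 L = (THE a. a \<in> gauss_ints_on L \<and>
     Re (complex_of_gauss a) > Re (complex_of_gauss (line_alpha0 L)) \<and>
     (\<forall>b\<in>gauss_ints_on L.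
        Re (complex_of_gauss b) > Re (complex_of_gauss (line_alpha0 L)) \<longrightarrow>
        dist (complex_of_gauss a) (complex_of_gauss (line_alpha0 L))
          \<le> dist (complex_of_gauss b) (complex_of_gauss (line_alpha0 L))))"

definition line_delta :: "complex set \<Rightarrow> gauss_int" where
  "line_delta L = (if vertical_line L then gauss_i else line_alpha1 L - line_alpha0 L)"

definition line_alpha :: "complex set \<Rightarrow> int \<Rightarrow> gauss_int" where
  "line_alpha L n = line_alpha0 L + line_delta L * of_int n"

definition gaussian_prime_set :: "complex set \<Rightarrow> gauss_int set" where
  "gaussian_prime_set L = {p. prime_elem p \<and> \<not> associate_of_rational_int p \<and>
     (\<exists>n. p dvd line_alpha L n)}"

end

theory Submission
  imports Defs
begin

text \<open>
  The Gaussian integers on \<open>L\<close> are exactly the \<open>\<alpha>\<^sub>n\<close>, so a prime dividing both \<open>\<delta>\<close> and some \<open>\<alpha>\<^sub>n\<close>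
  divides all of them, against primitivity.  Conversely, \<open>\<pi> = a + bi\<close> has coprime coordinates, as it
  is not an associate of a rational integer; hence \<open>i\<close>, and with it every Gaussian integer, is
  congruent modulo \<open>\<pi>\<close> to a rational integer.  A rational integer not divisible by \<open>\<pi>\<close> is coprime to
  \<open>a\<^sup>2 + b\<^sup>2\<close>, so it is invertible modulo \<open>\<pi>\<close> by a rational integer, and \<open>\<alpha>\<^sub>0 + \<delta> n \<equiv> 0\<close> can be solved
  for a rational integer \<open>n\<close> whenever \<open>\<pi>\<close> does not divide \<open>\<delta>\<close>.
\<close>

section \<open>Coordinates of Gaussian integers\<close>

definition gauss_of :: "int \<Rightarrow> int \<Rightarrow> gauss_int" where
  "gauss_of a b = of_int a + gauss_i * of_int b"

lemma complex_of_gauss_simps [simp]: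
  "complex_of_gauss 0 = 0" "complex_of_gauss 1 = 1"
  "complex_of_gauss (x + y) = complex_of_gauss x + complex_of_gauss y"
  "complex_of_gauss (x - y) = complex_of_gauss x - complex_of_gauss y"
  "complex_of_gauss (- x) = - complex_of_gauss x"
  "complex_of_gauss (x * y) = complex_of_gauss x * complex_of_gauss y"
  "complex_of_gauss gauss_i = \<i>"
  by (transfer; simp)+

lemma complex_of_gauss_of_nat [simp]: "complex_of_gauss (of_nat n) = of_nat n"
  by (induction n) auto

lemma complex_of_gauss_of_int [simp]: "complex_of_gauss (of_int n) = of_int n"
  by (cases n) auto

lemma Re_gauss_of [simp]: "Re (complex_of_gauss (gauss_of a b)) = of_int a"
  and Im_gauss_of [simp]: "Im (complex_of_gauss (gauss_of a b)) = of_int b"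
  by (simp_all add: gauss_of_def)

lemma gauss_of_cases [cases type: gauss_int]:
  obtains a b where "z = gauss_of a b"
proof -
  have "Re (complex_of_gauss z) \<in> \<int>" "Im (complex_of_gauss z) \<in> \<int>"
    using complex_of_gauss[of z] by auto
  then obtain a b where "Re (complex_of_gauss z) = of_int a" "Im (complex_of_gauss z) = of_int b"
    by (auto elim!: Ints_cases)
  then have "complex_of_gauss z = complex_of_gauss (gauss_of a b)"
    by (simp add: complex_eq_iff)
  then show ?thesis
    using that complex_of_gauss_inject by blast
qed

lemma gauss_of_eq_iff [simp]: "gauss_of a b = gauss_of c d \<longleftrightarrow> a = c \<and> b = d"
  by (metis Re_gauss_of Im_gauss_of of_int_eq_iff)

lemma gauss_i_squared: "gauss_i * gauss_i = - 1"
  by transfer simp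

lemma gauss_of_add: "gauss_of a b + gauss_of c d = gauss_of (a + c) (b + d)"
  by (simp add: gauss_of_def algebra_simps)

lemma gauss_of_mult: "gauss_of a b * gauss_of c d = gauss_of (a * c - b * d) (a * d + b * c)"
proof -
  have "gauss_of a b * gauss_of c d =
      of_int (a * c) + (gauss_i * gauss_i) * of_int (b * d) + gauss_i * of_int (a * d + b * c)"
    by (simp add: gauss_of_def algebra_simps)
  then show ?thesis
    by (simp add: gauss_i_squared gauss_of_def algebra_simps)
qed

lemma of_int_eq_gauss_of: "of_int n = gauss_of n 0"
  by (simp add: gauss_of_def)

lemma gauss_norm_gauss_of: "gauss_norm (gauss_of a b) = of_int (a\<^sup>2 + b\<^sup>2)"
  by (simp add: gauss_norm_def)

lemma of_int_dvd_gauss_of_iff: "of_int n dvd gauss_of a b \<longleftrightarrow> n dvd a \<and> n dvd b"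
proof
  assume "of_int n dvd gauss_of a b"
  then obtain z where z: "gauss_of a b = of_int n * z" ..
  then show "n dvd a \<and> n dvd b"
    by (cases z) (simp add: of_int_eq_gauss_of gauss_of_mult)
next
  assume "n dvd a \<and> n dvd b"
  then obtain k l where "a = n * k" "b = n * l"
    by (auto elim!: dvdE)
  then have "gauss_of a b = of_int n * gauss_of k l"
    by (simp add: of_int_eq_gauss_of gauss_of_mult)
  then show "of_int n dvd gauss_of a b" ..
qed

text \<open>The norm is multiplicative, so the norm of a unit divides 1 and only four lattice points
  qualify. This links \<open>dvd 1\<close> to the four factors listed in
  \<open>gauss_associates\<close>.\<close>

lemma gauss_unit_iff: "(u :: gauss_int) dvd 1 \<longleftrightarrow> u \<in> {1, -1, gauss_i, -gauss_i}"
proof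
  assume "u dvd 1"
  then obtain v where uv: "1 = u * v" ..
  obtain a b where u: "u = gauss_of a b" by (cases u)
  obtain c d where v: "v = gauss_of c d" by (cases v)
  have "gauss_of 1 0 = gauss_of (a * c - b * d) (a * d + b * c)"
    using uv unfolding u v gauss_of_mult by (simp add: gauss_of_def)
  then have "a * c - b * d = 1" "a * d + b * c = 0" by simp_all
  \<comment> \<open>Multiplicativity of the norm, as the two-squares identity.\<close>
  moreover have "(a\<^sup>2 + b\<^sup>2) * (c\<^sup>2 + d\<^sup>2) = (a * c - b * d)\<^sup>2 + (a * d + b * c)\<^sup>2"
    by (simp add: power2_eq_square algebra_simps)
  ultimately have "a\<^sup>2 + b\<^sup>2 dvd 1"
    by (metis dvdI power_one zero_power2 add_0_right)
  then have n: "a\<^sup>2 + b\<^sup>2 = 1"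
    by (metis abs_of_nonneg sum_power2_ge_zero zdvd1_eq)
  then have "a\<^sup>2 \<le> 1" "b\<^sup>2 \<le> 1"
    using zero_le_power2[of a] zero_le_power2[of b] by linarith+
  then have "\<bar>a\<bar> \<le> 1" "\<bar>b\<bar> \<le> 1"
    by (simp_all add: abs_square_le_1)
  then have "a \<in> {-1, 0, 1}" "b \<in> {-1, 0, 1}" by auto
  then show "u \<in> {1, -1, gauss_i, -gauss_i}"
    using n by (auto simp: u gauss_of_def)
next
  have "gauss_i dvd 1"
    using dvd_triv_left[of gauss_i gauss_i] by (simp add: gauss_i_squared)
  then show "u \<in> {1, -1, gauss_i, -gauss_i} \<Longrightarrow> u dvd 1" by auto
qed

section \<open>Residues modulo a Gaussian prime\<close>

text \<open>Factor the prime as \<open>gcd a b\<close> times \<open>z\<close>. A unit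
  \<open>z\<close> would make it an associate of a rational integer, so the prime divides
  \<open>z\<close>, and cancelling it leaves \<open>gcd a b\<close> a unit.\<close>

lemma coprime_of_not_associate_of_rational_int:
  assumes "prime_elem (gauss_of a b)" and "\<not> associate_of_rational_int (gauss_of a b)"
  shows "coprime a b"
proof -
  have "of_int (gcd a b) dvd gauss_of a b"
    by (simp add: of_int_dvd_gauss_of_iff)
  then obtain z where z: "gauss_of a b = of_int (gcd a b) * z" ..
  have "\<not> z dvd 1"
  proof
    assume "z dvd 1"
    then have "gauss_associates (gauss_of a b) (of_int (gcd a b))"
      unfolding gauss_unit_iff gauss_associates_def z by (metis mult.commute)
    then show False
      using assms(2) unfolding associate_of_rational_int_def by blast
  qed
  \<comment> \<open>This excludes the other factor: if the prime divided the gcd, cancelling the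
    prime would make \<open>z\<close> a unit.\<close>
  moreover have "z dvd 1" if "gauss_of a b dvd of_int (gcd a b)"
  proof -
    from that obtain k where "of_int (gcd a b) = gauss_of a b * k" ..
    then have "gauss_of a b * (k * z) = gauss_of a b * 1"
      using z by (metis mult.assoc mult.right_neutral)
    then have "1 = z * k"
      using assms(1) by (simp add: prime_elem_def mult.commute)
    then show ?thesis ..
  qed
  ultimately have "gauss_of a b dvd z"
    using assms(1) z by (metis dvd_refl prime_elem_dvd_mult_iff)
  then obtain k where "z = gauss_of a b * k" ..
  then have "gauss_of a b * (of_int (gcd a b) * k) = gauss_of a b * 1"
    using z by (metis mult.left_commute mult.right_neutral)
  then have "1 = of_int (gcd a b) * k"
    using assms(1) by (simp add: prime_elem_def)
  then have "of_int (gcd a b) dvd (1 :: gauss_int)" ..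
  then have "gcd a b dvd 1"
    using of_int_dvd_gauss_of_iff[of "gcd a b" 1 0] by (simp add: gauss_of_def)
  then show ?thesis
    by (simp add: coprime_iff_gcd_eq_1)
qed

lemma rational_residue:
  assumes "coprime a b"
  obtains m where "gauss_of a b dvd z - of_int m"
proof -
  obtain u v where uv: "u * a + v * b = 1"
    using assms by (metis bezout_int coprime_iff_gcd_eq_1)
  obtain x y where z: "z = gauss_of x y" by (cases z)
  \<comment> \<open>The Bezout coefficients, placed as \<open>v + u i\<close>, give the product
    imaginary part \<open>u * a + v * b = 1\<close>. So i is congruent to a rational integer, which
    then replaces i in \<open>z = x + y i\<close>.\<close>
  have "gauss_of a b * gauss_of v u = gauss_i - of_int (b * u - a * v)"
    using uv by (simp add: gauss_of_mult) (simp add: gauss_of_def algebra_simps)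
  then have "gauss_of a b dvd (gauss_i - of_int (b * u - a * v)) * of_int y"
    by (metis dvd_triv_left dvd_mult2)
  also have "\<dots> = z - of_int (x + (b * u - a * v) * y)"
    by (simp add: z gauss_of_def algebra_simps)
  finally show ?thesis using that by blast
qed

text \<open>The point is that \<open>g = gcd m N\<close> is 1 for the norm \<open>N\<close>. The
  prime divides \<open>N = g * h\<close> but not \<open>g\<close>, hence divides \<open>h\<close>;
  cancelling it from \<open>N\<close>, written as prime times conjugate, shows that \<open>g\<close>
  divides the conjugate, hence both coprime coordinates.\<close>

lemma rational_inverse:
  assumes "prime_elem (gauss_of a b)" and "coprime a b" and "\<not> gauss_of a b dvd of_int m"
  obtains k where "gauss_of a b dvd of_int (m * k - 1)"
proof -
  define N where "N = a\<^sup>2 + b\<^sup>2"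
  define g where "g = gcd m N"
  have N: "of_int N = gauss_of a b * gauss_of a (- b)"
    by (simp add: gauss_of_mult of_int_eq_gauss_of N_def power2_eq_square)
  obtain h where h: "N = g * h"
    unfolding g_def by (meson dvdE gcd_dvd2)
  have "\<not> gauss_of a b dvd of_int g"
  proof -
    have "(of_int g :: gauss_int) dvd of_int m"
      unfolding g_def by (metis dvd_def gcd_dvd1 of_int_mult)
    then show ?thesis
      using assms(3) dvd_trans by blast
  qed
  moreover have "gauss_of a b dvd of_int g * of_int h"
    using N h by (metis dvd_triv_left of_int_mult)
  ultimately have "gauss_of a b dvd of_int h"
    using assms(1) prime_elem_dvd_mult_iff by blast
  then obtain c where "of_int h = gauss_of a b * c" ..
  then have "gauss_of a b * gauss_of a (- b) = gauss_of a b * (of_int g * c)"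
    using N h by (metis mult.left_commute of_int_mult)
  then have "gauss_of a (- b) = of_int g * c"
    using assms(1) by (simp add: prime_elem_def)
  then have "of_int g dvd gauss_of a (- b)" ..
  then have "g = 1"
    using assms(2) unfolding of_int_dvd_gauss_of_iff g_def
    by (metis coprime_common_divisor dvd_minus_iff gcd_ge_0_int abs_of_nonneg zdvd1_eq)
  then obtain k l where kl: "k * m + l * N = 1"
    unfolding g_def by (metis bezout_int)
  \<comment> \<open>The Bezout relation makes \<open>m * k - 1\<close> a multiple of
    \<open>N\<close>, hence of the prime.\<close>
  have "of_int (m * k - 1) = gauss_of a b * (gauss_of a (- b) * of_int (- l))"
  proof -
    have "m * k - 1 = N * (- l)" using kl by (simp add: algebra_simps)
    then show ?thesis by (metis N of_int_mult mult.assoc)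
  qed
  then show ?thesis
    using that by (metis dvd_triv_left)
qed

lemma ex_dvd_progression:
  assumes "prime_elem p" and "\<not> associate_of_rational_int p" and "\<not> p dvd d"
  obtains n :: int where "p dvd z + d * of_int n"
proof -
  obtain a b where p: "p = gauss_of a b" by (cases p)
  have co: "coprime a b"
    using assms coprime_of_not_associate_of_rational_int by (simp add: p)
  obtain r where r: "p dvd z - of_int r"
    using rational_residue[OF co] unfolding p by blast
  obtain m where m: "p dvd d - of_int m"
    using rational_residue[OF co] unfolding p by blast
  have "\<not> p dvd of_int m"
    using dvd_add[OF m] assms(3) by (metis diff_add_cancel)
  then obtain k where k: "p dvd of_int (m * k - 1)"
    using rational_inverse assms(1) co unfolding p by blast
  \<comment> \<open>With z \<equiv> r, d \<equiv> m and m k \<equiv> 1 modulo \<open>p\<close>, the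
    solution is n = - k r. The three multiples of \<open>p\<close> are combined so that all terms in
    \<open>r\<close> and \<open>m\<close> cancel.\<close>
  have "p dvd (z - of_int r) - (d - of_int m) * of_int (k * r) - of_int (m * k - 1) * of_int r"
    by (intro dvd_diff[OF dvd_diff] dvd_mult2 r m k)
  also have "\<dots> = z + d * of_int (- (k * r))"
    by (simp add: algebra_simps)
  finally show ?thesis using that by blast
qed

section \<open>Gaussian lines\<close>

text \<open>The equation says that the cross product of \<open>v - z\<close> and
  \<open>w - z\<close> vanishes; this form stays polynomial and covers vertical lines too.\<close>

lemma line_through_iff:
  fixes z w v :: complex
  assumes "affine L" "aff_dim L = 1" "z \<in> L" "w \<in> L" "z \<noteq> w"
  shows "v \<in> L \<longleftrightarrow> (Re v - Re z) * (Im w - Im z) = (Im v - Im z) * (Re w - Re z)"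
proof -
  \<comment> \<open>The hull lies in \<open>L\<close>, and both are affine of dimension 1.\<close>
  have "affine hull {z, w} = L"
    using assms by (intro affine_dim_equal) (auto simp: hull_minimal aff_dim_affine_hull aff_dim_2)
  then have L: "L = {z + of_real t * (w - z) |t. True}"
    unfolding affine_hull_2_alt by (auto simp: scaleR_conv_of_real image_def)
  show ?thesis
  proof
    assume "v \<in> L"
    then show "(Re v - Re z) * (Im w - Im z) = (Im v - Im z) * (Re w - Re z)"
      unfolding L by auto
  next
    assume eq: "(Re v - Re z) * (Im w - Im z) = (Im v - Im z) * (Re w - Re z)"
    have "\<exists>t. v = z + of_real t * (w - z)"
    proof (cases "Re w = Re z")
      case True
      then have "Im w - Im z \<noteq> 0" using assms(5) by (auto simp: complex_eq_iff)
      with eq True show ?thesis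
        by (intro exI[of _ "(Im v - Im z) / (Im w - Im z)"]) (auto simp: complex_eq_iff field_simps)
    next
      case False
      with eq show ?thesis
        by (intro exI[of _ "(Re v - Re z) / (Re w - Re z)"]) (auto simp: complex_eq_iff field_simps)
    qed
    then show "v \<in> L" unfolding L by blast
  qed
qed

text \<open>Dividing the difference of two lattice points by the gcd of its coordinates gives a
  primitive direction \<open>(c, d)\<close>; coprimality then leaves no lattice point between
  consecutive terms of the progression.\<close>

lemma gauss_ints_on_nonvertical:
  assumes "gaussian_line L" and "\<not> vertical_line L"
  obtains x y c d where "c > 0"
    and "gauss_ints_on L = range (\<lambda>n. gauss_of (x + c * n) (y + d * n))"
proof -
  obtain z w where zw: "z \<in> gauss_ints_on L" "w \<in> gauss_ints_on L" "z \<noteq> w"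
    and L: "affine L" "aff_dim L = 1"
    using assms(1) unfolding gaussian_line_def by blast
  obtain x y where z: "z = gauss_of x y" by (cases z)
  obtain x' y' where w: "w = gauss_of x' y'" by (cases w)
  have iff: "v \<in> L \<longleftrightarrow> (Re v - x) * (y' - y) = (Im v - y) * (x' - x)" for v
    using line_through_iff[OF L, of "complex_of_gauss z" "complex_of_gauss w" v] zw
    by (simp add: gauss_ints_on_def complex_of_gauss_inject z w)
  have "x' \<noteq> x"
  proof
    assume "x' = x"
    then have "L = {v. Re v = x}"
      using iff zw(3) by (auto simp: z w)
    then show False
      using assms(2) unfolding vertical_line_def by blast
  qed
  \<comment> \<open>The factor \<open>sgn (x' - x)\<close> gives \<open>g\<close> the sign of
    \<open>x' - x\<close>, so that the quotient \<open>c\<close> is positive.\<close>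
  define g where "g = gcd (x' - x) (y' - y) * sgn (x' - x)"
  have gcd_pos: "gcd (x' - x) (y' - y) > 0"
    using \<open>x' \<noteq> x\<close> by simp
  have "g dvd x' - x" "g dvd y' - y" "g \<noteq> 0"
    using \<open>x' \<noteq> x\<close> by (auto simp: g_def sgn_if)
  then obtain c d where c: "x' - x = g * c" and d: "y' - y = g * d"
    by (auto elim!: dvdE)
  have "gcd (x' - x) (y' - y) = \<bar>g\<bar> * gcd c d"
    unfolding c d by (simp add: gcd_mult_distrib_int)
  moreover have "gcd (x' - x) (y' - y) = \<bar>g\<bar>"
    using \<open>x' \<noteq> x\<close> gcd_pos by (simp add: g_def abs_mult abs_sgn_eq)
  ultimately have co: "coprime c d"
    using \<open>g \<noteq> 0\<close> by (simp add: coprime_iff_gcd_eq_1)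
  have "c > 0"
  proof -
    have "sgn (x' - x) = sgn g"
      using gcd_pos by (simp add: g_def sgn_mult)
    then have "sgn g = sgn g * sgn c"
      unfolding c by (simp add: sgn_mult)
    then show ?thesis
      using \<open>g \<noteq> 0\<close> by (simp add: sgn_if split: if_splits)
  qed
  have mem: "gauss_of p q \<in> gauss_ints_on L \<longleftrightarrow> (p - x) * d = (q - y) * c" for p q
  proof -
    have "gauss_of p q \<in> gauss_ints_on L \<longleftrightarrow>
        real_of_int ((p - x) * (y' - y)) = real_of_int ((q - y) * (x' - x))"
      by (simp add: gauss_ints_on_def iff)
    also have "\<dots> \<longleftrightarrow> (p - x) * (y' - y) = (q - y) * (x' - x)"
      by (rule of_int_eq_iff)
    also have "\<dots> \<longleftrightarrow> g * ((p - x) * d) = g * ((q - y) * c)"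
      unfolding c d by (simp only: mult.left_commute)
    finally show ?thesis
      using \<open>g \<noteq> 0\<close> by simp
  qed
  have "gauss_ints_on L = range (\<lambda>n. gauss_of (x + c * n) (y + d * n))"
  proof (intro equalityI subsetI)
    fix v assume v: "v \<in> gauss_ints_on L"
    obtain p q where pq: "v = gauss_of p q" by (cases v)
    have eq: "(p - x) * d = (q - y) * c"
      using v mem unfolding pq by blast
    \<comment> \<open>\<open>c\<close> divides \<open>(p - x) * d\<close> and is coprime to
      \<open>d\<close>.\<close>
    then have "c dvd p - x"
      using co by (metis coprime_dvd_mult_left_iff dvd_triv_right)
    then obtain n where n: "p - x = c * n" ..
    with eq \<open>c > 0\<close> have "q - y = d * n" by (simp add: mult.commute)
    with n show "v \<in> range (\<lambda>n. gauss_of (x + c * n) (y + d * n))"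
      by (auto simp: pq algebra_simps intro!: image_eqI[of _ _ n])
  qed (auto simp: mem)
  with \<open>c > 0\<close> that show ?thesis by blast
qed

section \<open>Determining \<open>line_alpha0\<close> and \<open>line_alpha1\<close>\<close>

lemma line_alpha0_eqI:
  assumes "a \<in> gauss_ints_on L"
    and "\<And>b. b \<in> gauss_ints_on L \<Longrightarrow> b \<noteq> a \<Longrightarrow> gauss_norm a < gauss_norm b \<or>
      gauss_norm a = gauss_norm b \<and> Re (complex_of_gauss b) < Re (complex_of_gauss a)"
  shows "line_alpha0 L = a"
  unfolding line_alpha0_def
proof (rule the_equality)
  have "gauss_norm a \<le> gauss_norm b" if "b \<in> gauss_ints_on L" for b
    using assms(2)[OF that] by force
  moreover have "Re (complex_of_gauss b) \<le> Re (complex_of_gauss a)"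
    if "b \<in> gauss_ints_on L" "gauss_norm b = gauss_norm a" for b
    using assms(2)[OF that(1)] that(2) by force
  ultimately show "a \<in> gauss_ints_on L \<and>
     (\<forall>b\<in>gauss_ints_on L. gauss_norm a \<le> gauss_norm b) \<and>
     (\<forall>b\<in>gauss_ints_on L. gauss_norm b = gauss_norm a \<longrightarrow>
        Re (complex_of_gauss b) \<le> Re (complex_of_gauss a))"
    using assms(1) by blast
next
  fix b
  assume "b \<in> gauss_ints_on L \<and>
     (\<forall>b'\<in>gauss_ints_on L. gauss_norm b \<le> gauss_norm b') \<and>
     (\<forall>b'\<in>gauss_ints_on L. gauss_norm b' = gauss_norm b \<longrightarrow>
        Re (complex_of_gauss b') \<le> Re (complex_of_gauss b))"
  \<comment> \<open>A second candidate would have strictly larger norm, or equal norm and strictly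
    smaller real part; either contradicts its own optimality.\<close>
  then show "b = a"
    using assms by (metis leD)
qed

lemma gauss_ints_on_vertical:
  assumes "gaussian_line L" and "vertical_line L"
  shows "gauss_ints_on L = range (line_alpha L)"
proof -
  obtain z where "z \<in> gauss_ints_on L"
    using assms(1) unfolding gaussian_line_def by blast
  moreover obtain e where "L = {z. Re z = e}"
    using assms(2) unfolding vertical_line_def by blast
  ultimately obtain x where L: "L = {z. Re z = of_int x}"
    by (cases z) (auto simp: gauss_ints_on_def)
  have mem: "gauss_of p q \<in> gauss_ints_on L \<longleftrightarrow> p = x" for p q
    by (simp add: gauss_ints_on_def L)
  \<comment> \<open>The norm on this line is \<open>x\<^sup>2\<close> plus the square of the
    imaginary part, so the point on the real axis is the strict minimiser and no tie arises.\<close>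
  have "line_alpha0 L = gauss_of x 0"
  proof (rule line_alpha0_eqI)
    fix b assume "b \<in> gauss_ints_on L" "b \<noteq> gauss_of x 0"
    then show "gauss_norm (gauss_of x 0) < gauss_norm b \<or>
      gauss_norm (gauss_of x 0) = gauss_norm b \<and>
      Re (complex_of_gauss b) < Re (complex_of_gauss (gauss_of x 0))"
      by (cases b) (auto simp: mem gauss_norm_gauss_of)
  qed (simp add: mem)
  then have "line_alpha L n = gauss_of x n" for n
    using assms(2) by (simp add: line_alpha_def line_delta_def gauss_of_def)
  moreover have "gauss_ints_on L = range (gauss_of x)"
  proof (intro equalityI subsetI)
    fix v assume "v \<in> gauss_ints_on L"
    then show "v \<in> range (gauss_of x)" by (cases v) (auto simp: mem)
  qed (auto simp: mem)
  ultimately show ?thesis by simp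
qed

text \<open>
  Rounding the vertex of the parabola \<open>A n\<^sup>2 + 2 B n\<close> half up yields the minimiser, and the larger
  of the two in case of a tie.
\<close>

lemma quadratic_minimiser:
  fixes A B :: real
  assumes "A > 0"
  obtains m :: int where "\<And>n. n > m \<Longrightarrow> A * m\<^sup>2 + 2 * B * m < A * n\<^sup>2 + 2 * B * n"
    and "\<And>n. n < m \<Longrightarrow> A * m\<^sup>2 + 2 * B * m \<le> A * n\<^sup>2 + 2 * B * n"
proof -
  define m where "m = \<lfloor>- B / A + 1 / 2\<rfloor>"
  have "of_int m \<le> - B / A + 1 / 2" "- B / A + 1 / 2 < of_int m + 1"
    unfolding m_def by linarith+
  then have m: "A * (2 * m - 1) \<le> - 2 * B" "- 2 * B < A * (2 * m + 1)"
    using assms by (simp_all add: field_simps)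
  \<comment> \<open>With this factorisation, the bounds \<open>m\<close> fix the sign of the second
    factor on each side of the minimiser.\<close>
  have diff: "(A * n\<^sup>2 + 2 * B * n) - (A * m\<^sup>2 + 2 * B * m) = (n - m) * (A * (n + m) + 2 * B)"
    for n :: int
    by (simp add: power2_eq_square algebra_simps)
  show ?thesis
  proof (rule that)
    fix n :: int assume n: "n > m"
    then have "A * (2 * m + 1) \<le> A * (n + m)"
      using assms by (intro mult_left_mono) linarith+
    then have "0 < (n - m) * (A * (n + m) + 2 * B)"
      using n m by (intro mult_pos_pos) auto
    then show "A * m\<^sup>2 + 2 * B * m < A * n\<^sup>2 + 2 * B * n"
      using diff[of n] by linarith
  next
    fix n :: int assume n: "n < m"
    then have "A * (n + m) \<le> A * (2 * m - 1)"
      using assms by (intro mult_left_mono) linarith+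
    then have "0 \<le> (n - m) * (A * (n + m) + 2 * B)"
      using n m by (intro mult_nonpos_nonpos) auto
    then show "A * m\<^sup>2 + 2 * B * m \<le> A * n\<^sup>2 + 2 * B * n"
      using diff[of n] by linarith
  qed
qed

lemma line_alpha0_nonvertical:
  assumes "c > 0" and "gauss_ints_on L = range (\<lambda>n. gauss_of (x + c * n) (y + d * n))"
  obtains m where "line_alpha0 L = gauss_of (x + c * m) (y + d * m)"
proof -
  \<comment> \<open>Along the progression the norm is \<open>A * n\<^sup>2 + 2 * B * n\<close> plus
    a constant: \<open>A\<close> is the norm of the direction and \<open>B\<close> its inner product
    with the starting point.\<close>
  define A where "A = real_of_int (c\<^sup>2 + d\<^sup>2)"
  define B where "B = real_of_int (x * c + y * d)"
  have "A > 0"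
    using assms(1) by (simp add: A_def add_pos_nonneg)
  from quadratic_minimiser[OF this, of B] obtain m :: int
    where gt: "\<And>n. n > m \<Longrightarrow> A * m\<^sup>2 + 2 * B * m < A * n\<^sup>2 + 2 * B * n"
      and lt: "\<And>n. n < m \<Longrightarrow> A * m\<^sup>2 + 2 * B * m \<le> A * n\<^sup>2 + 2 * B * n"
    by blast
  have norm: "gauss_norm (gauss_of (x + c * n) (y + d * n)) = A * n\<^sup>2 + 2 * B * n + (x\<^sup>2 + y\<^sup>2)" for n
    by (simp add: gauss_norm_gauss_of A_def B_def power2_eq_square algebra_simps)
  have "line_alpha0 L = gauss_of (x + c * m) (y + d * m)"
  proof (rule line_alpha0_eqI)
    fix b assume b: "b \<in> gauss_ints_on L" "b \<noteq> gauss_of (x + c * m) (y + d * m)"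
    then obtain n where n: "b = gauss_of (x + c * n) (y + d * n)" "n \<noteq> m"
      unfolding assms(2) by auto
    \<comment> \<open>As \<open>c > 0\<close>, a smaller index means a smaller real part, so the
      larger index chosen in a tie is the one that \<open>line_alpha0\<close> prefers.\<close>
    have "c * n < c * m" if "n < m"
      using that assms(1) by simp
    then have "Re (complex_of_gauss b) < Re (complex_of_gauss (gauss_of (x + c * m) (y + d * m)))"
      if "n < m"
      using that unfolding n Re_gauss_of of_int_less_iff by simp
    then show "gauss_norm (gauss_of (x + c * m) (y + d * m)) < gauss_norm b \<or>
      gauss_norm (gauss_of (x + c * m) (y + d * m)) = gauss_norm b \<and>
      Re (complex_of_gauss b) < Re (complex_of_gauss (gauss_of (x + c * m) (y + d * m)))"
      using gt[of n] lt[of n] n(2) unfolding n(1) norm by linarith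
  qed (auto simp: assms(2))
  with that show ?thesis .
qed

text \<open>The term of index \<open>n\<close> lies at distance \<bar>n\<bar> times the modulus of
  \<open>d\<close> from \<alpha>0, and to its right exactly when \<open>n > 0\<close>; hence
  \<open>n = 1\<close> is the unique nearest choice.\<close>

lemma line_alpha1_eqI:
  assumes "Re (complex_of_gauss d) > 0"
    and "gauss_ints_on L = range (\<lambda>n. line_alpha0 L + d * of_int n)"
  shows "line_alpha1 L = line_alpha0 L + d"
  unfolding line_alpha1_def
proof (rule the_equality)
  have d: "cmod (complex_of_gauss d) > 0"
    using assms(1) by auto
  have right: "Re (complex_of_gauss (line_alpha0 L)) <
      Re (complex_of_gauss (line_alpha0 L + d * of_int n)) \<longleftrightarrow> n > 0" for n
    using assms(1) by (simp add: zero_less_mult_iff)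
  have d_mem: "line_alpha0 L + d \<in> gauss_ints_on L"
    unfolding assms(2) by (rule image_eqI[of _ _ 1]) auto
  have "dist (complex_of_gauss (line_alpha0 L + d)) (complex_of_gauss (line_alpha0 L))
        \<le> dist (complex_of_gauss b) (complex_of_gauss (line_alpha0 L))"
    if b: "b \<in> gauss_ints_on L"
      "Re (complex_of_gauss b) > Re (complex_of_gauss (line_alpha0 L))" for b
  proof -
    obtain n where n: "b = line_alpha0 L + d * of_int n"
      using b(1) unfolding assms(2) by blast
    then have "n > 0" using b(2) right by blast
    then show ?thesis
      using d by (simp add: n dist_norm norm_mult)
  qed
  then show "line_alpha0 L + d \<in> gauss_ints_on L \<and>
     Re (complex_of_gauss (line_alpha0 L + d)) > Re (complex_of_gauss (line_alpha0 L)) \<and>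
     (\<forall>b\<in>gauss_ints_on L.
        Re (complex_of_gauss b) > Re (complex_of_gauss (line_alpha0 L)) \<longrightarrow>
        dist (complex_of_gauss (line_alpha0 L + d)) (complex_of_gauss (line_alpha0 L))
          \<le> dist (complex_of_gauss b) (complex_of_gauss (line_alpha0 L)))"
    using d_mem assms(1) by simp
  fix a
  assume a: "a \<in> gauss_ints_on L \<and>
     Re (complex_of_gauss a) > Re (complex_of_gauss (line_alpha0 L)) \<and>
     (\<forall>b\<in>gauss_ints_on L.
        Re (complex_of_gauss b) > Re (complex_of_gauss (line_alpha0 L)) \<longrightarrow>
        dist (complex_of_gauss a) (complex_of_gauss (line_alpha0 L))
          \<le> dist (complex_of_gauss b) (complex_of_gauss (line_alpha0 L)))"
  then obtain n where n: "a = line_alpha0 L + d * of_int n"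
    unfolding assms(2) by blast
  then have "n > 0" using a right by blast
  have "Re (complex_of_gauss (line_alpha0 L + d)) > Re (complex_of_gauss (line_alpha0 L))"
    using assms(1) by simp
  with a d_mem have "dist (complex_of_gauss a) (complex_of_gauss (line_alpha0 L))
      \<le> dist (complex_of_gauss (line_alpha0 L + d)) (complex_of_gauss (line_alpha0 L))"
    by blast
  then have "n \<le> 1"
    using d \<open>n > 0\<close> by (simp add: n dist_norm norm_mult)
  with \<open>n > 0\<close> have "n = 1" by simp
  then show "a = line_alpha0 L + d"
    by (simp add: n)
qed

section \<open>Exhausting the Gaussian integers on a line by the \<open>line_alpha L n\<close>, and
  the divisibility criterion\<close>

lemma gauss_ints_on_eq_range_line_alpha:
  assumes "gaussian_line L"
  shows "gauss_ints_on L = range (line_alpha L)"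
proof (cases "vertical_line L")
  case True
  with assms show ?thesis by (rule gauss_ints_on_vertical)
next
  case False
  from gauss_ints_on_nonvertical[OF assms False] obtain x y c d where c: "c > 0"
    and L: "gauss_ints_on L = range (\<lambda>n. gauss_of (x + c * n) (y + d * n))" .
  from line_alpha0_nonvertical[OF this] obtain m
    where m: "line_alpha0 L = gauss_of (x + c * m) (y + d * m)" .
  \<comment> \<open>Shifting the index by \<open>m\<close> is a bijection of the integers and puts
    \<alpha>0 at index 0.\<close>
  have "gauss_ints_on L = range ((\<lambda>n. gauss_of (x + c * n) (y + d * n)) \<circ> (\<lambda>n. m + n))"
    unfolding L image_comp[symmetric] by (simp add: surj_plus)
  also have "\<dots> = range (\<lambda>n. line_alpha0 L + gauss_of c d * of_int n)"
    unfolding m by (simp add: of_int_eq_gauss_of gauss_of_mult gauss_of_add algebra_simps)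
  finally have L': "gauss_ints_on L = range (\<lambda>n. line_alpha0 L + gauss_of c d * of_int n)" .
  moreover have "line_delta L = gauss_of c d"
    using line_alpha1_eqI[OF _ L'] c False by (simp add: line_delta_def)
  ultimately show ?thesis
    by (simp add: line_alpha_def[abs_def])
qed

theorem theorem5:
  fixes L :: "complex set" and \<pi> :: gauss_int
  assumes "gaussian_line L"
    and "primitive_line L"
    and "prime_elem \<pi>"
    and "\<not> associate_of_rational_int \<pi>"
  shows "\<pi> \<in> gaussian_prime_set L \<longleftrightarrow> \<not> \<pi> dvd line_delta L"
proof
  assume "\<pi> \<in> gaussian_prime_set L"
  then obtain n where n: "\<pi> dvd line_alpha0 L + line_delta L * of_int n"
    unfolding gaussian_prime_set_def line_alpha_def by blast
  show "\<not> \<pi> dvd line_delta L"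
  proof
    assume dvd: "\<pi> dvd line_delta L"
    with n have "\<pi> dvd line_alpha0 L"
      by (simp add: dvd_add_left_iff)
    with dvd have "\<forall>z\<in>gauss_ints_on L. \<pi> dvd z"
      unfolding gauss_ints_on_eq_range_line_alpha[OF assms(1)] line_alpha_def by auto
    moreover have "\<not> \<pi> dvd 1"
      using assms(3) by (simp add: prime_elem_def)
    ultimately show False
      using assms(2) unfolding primitive_line_def by blast
  qed
next
  assume "\<not> \<pi> dvd line_delta L"
  then obtain n where "\<pi> dvd line_alpha0 L + line_delta L * of_int n"
    using ex_dvd_progression[OF assms(3,4)] by blast
  then show "\<pi> \<in> gaussian_prime_set L"
    using assms(3,4) unfolding gaussian_prime_set_def line_alpha_def by blast
qed

end
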